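(* Let $X$ be a symmetric space on $[0,1]$ which is an interpolation space with respect to the Banach couple $(L_1[0,1],L_\infty[0,1])$. Enumerate the functions $r_ir_j$, $1\le i<j<\infty$, as a sequence $\{\varphi_n\}_{n=1}^\infty$ by $$\varphi_{k(k-1)/2+i}=r_i\,r_{k+1}\qquad (k=1,2,\ldots;\ 1\le i\le k),$$ that is, $\varphi_1=r_1r_2,\ \varphi_2=r_1r_3,\ \varphi_3=r_2r_3,\ \varphi_4=r_1r_4,\ldots$. Then $\{\varphi_n\}_{n=1}^\infty$ is a basic sequence in $X$.
   Context: Rademacher functions: $r_k(t)=\operatorname{sign}\sin(2^{k-1}\pi t)$, $t\in[0,1]$, $k=1,2,\ldots$ (so $r_1=1$ a.e.). The system $\{r_ir_j\}_{1\le i<j<\infty}$ is called the Rademacher chaos of order 2. A symmetric space (s.s.) on $[0,1]$ is a nonzero Banach space $X$ of (classes of a.e. equal) real measurable functions on $[0,1]$ such that: if $y\in X$ and $|x|\le|y|$ a.e. with $x$ measurable, then $x\in X$ and $\|x\|_X\le\|y\|_X$; and if $y\in X$ and $|x|$, $|y|$ are equimeasurable, then $x\in X$ and $\|x\|_X=\|y\|_X$. One always has $L_\infty\subset X\subset L_1$ continuously. A Banach space $X$ is an interpolation space with respect to a Banach couple $(X_0,X_1)$ if $X_0\cap X_1\subset X\subset X_0+X_1$ and every linear operator bounded in both $X_0$ and $X_1$ is bounded in $X$. A sequence $\{x_n\}_{n=1}^\infty$ in a Banach space is a basic sequence if it is a (Schauder) basis of its closed linear span. *)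

theory Defs
  imports "HOL-Analysis.Analysis" "HOL-Probability.Essential_Supremum"
begin

text \<open>
  A Banach space of classes of a.e. equal functions on a measure space \<open>M\<close> is given by the set
  \<open>X\<close> of all representatives of its classes and by the norm \<open>N\<close>, which only depends on the class.
  Values outside the underlying set of \<open>M\<close> are irrelevant.
\<close>

definition banach_function_space ::
    "'a measure \<Rightarrow> ('a \<Rightarrow> real) set \<Rightarrow> (('a \<Rightarrow> real) \<Rightarrow> real) \<Rightarrow> bool" where
  "banach_function_space M X N \<longleftrightarrow>
     X \<subseteq> borel_measurable M \<and>
     (\<lambda>t. 0) \<in> X \<and>
     (\<forall>x\<in>X. \<forall>y\<in>X. (\<lambda>t. x t + y t) \<in> X \<and> N (\<lambda>t. x t + y t) \<le> N x + N y) \<and>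
     (\<forall>c. \<forall>x\<in>X. (\<lambda>t. c * x t) \<in> X \<and> N (\<lambda>t. c * x t) = \<bar>c\<bar> * N x) \<and>
     (\<forall>x\<in>X. \<forall>y\<in>borel_measurable M. (AE t in M. y t = x t) \<longrightarrow> y \<in> X \<and> N y = N x) \<and>
     (\<forall>x\<in>X. 0 \<le> N x \<and> (N x = 0 \<longleftrightarrow> (AE t in M. x t = 0))) \<and>
     (\<forall>u. (\<forall>n::nat. u n \<in> X) \<and>
          (\<forall>\<epsilon>>0. \<exists>K. \<forall>m\<ge>K. \<forall>n\<ge>K. N (\<lambda>t. u m t - u n t) < \<epsilon>) \<longrightarrow>
          (\<exists>x\<in>X. (\<lambda>n. N (\<lambda>t. u n t - x t)) \<longlonglongrightarrow> 0))"

definition equimeasurable :: "'a measure \<Rightarrow> ('a \<Rightarrow> real) \<Rightarrow> ('a \<Rightarrow> real) \<Rightarrow> bool" where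
  "equimeasurable M x y \<longleftrightarrow>
     (\<forall>\<tau>. emeasure M {t \<in> space M. x t > \<tau>} = emeasure M {t \<in> space M. y t > \<tau>})"

definition symmetric_space ::
    "'a measure \<Rightarrow> ('a \<Rightarrow> real) set \<Rightarrow> (('a \<Rightarrow> real) \<Rightarrow> real) \<Rightarrow> bool" where
  "symmetric_space M X N \<longleftrightarrow>
     banach_function_space M X N \<and>
     (\<exists>x\<in>X. \<not> (AE t in M. x t = 0)) \<and>
     (\<forall>y\<in>X. \<forall>x\<in>borel_measurable M.
        (AE t in M. \<bar>x t\<bar> \<le> \<bar>y t\<bar>) \<longrightarrow> x \<in> X \<and> N x \<le> N y) \<and>
     (\<forall>y\<in>X. \<forall>x\<in>borel_measurable M.
        equimeasurable M (\<lambda>t. \<bar>x t\<bar>) (\<lambda>t. \<bar>y t\<bar>) \<longrightarrow> x \<in> X \<and> N x = N y)"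

definition L1_space :: "'a measure \<Rightarrow> ('a \<Rightarrow> real) set" where
  "L1_space M = {f. integrable M f}"

definition L1_norm :: "'a measure \<Rightarrow> ('a \<Rightarrow> real) \<Rightarrow> real" where
  "L1_norm M f = (\<integral>t. \<bar>f t\<bar> \<partial>M)"

definition Linf_space :: "'a measure \<Rightarrow> ('a \<Rightarrow> real) set" where
  "Linf_space M = {f \<in> borel_measurable M. \<exists>C. AE t in M. \<bar>f t\<bar> \<le> C}"

definition Linf_norm :: "'a measure \<Rightarrow> ('a \<Rightarrow> real) \<Rightarrow> real" where
  "Linf_norm M f = real_of_ereal (esssup M (\<lambda>t. ereal \<bar>f t\<bar>))"

definition sum_space :: "('a \<Rightarrow> real) set \<Rightarrow> ('a \<Rightarrow> real) set \<Rightarrow> ('a \<Rightarrow> real) set" where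
  "sum_space X Y = {\<lambda>t. x t + y t | x y. x \<in> X \<and> y \<in> Y}"

text \<open>
  Linear operators act on representatives; compatibility with a.e. equality and linearity up to
  a.e. equality express that they are linear operators between the spaces of classes.
\<close>

definition linear_operator ::
    "'a measure \<Rightarrow> ('a \<Rightarrow> real) set \<Rightarrow> (('a \<Rightarrow> real) \<Rightarrow> ('a \<Rightarrow> real)) \<Rightarrow> bool" where
  "linear_operator M X T \<longleftrightarrow>
     (\<forall>x\<in>X. T x \<in> X) \<and>
     (\<forall>x\<in>X. \<forall>y\<in>X. (AE t in M. x t = y t) \<longrightarrow> (AE t in M. T x t = T y t)) \<and>
     (\<forall>x\<in>X. \<forall>y\<in>X. AE t in M. T (\<lambda>s. x s + y s) t = T x t + T y t) \<and>
     (\<forall>c. \<forall>x\<in>X. AE t in M. T (\<lambda>s. c * x s) t = c * T x t)"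

definition bounded_in ::
    "('a \<Rightarrow> real) set \<Rightarrow> (('a \<Rightarrow> real) \<Rightarrow> real) \<Rightarrow> (('a \<Rightarrow> real) \<Rightarrow> ('a \<Rightarrow> real)) \<Rightarrow> bool" where
  "bounded_in X N T \<longleftrightarrow> (\<exists>C. \<forall>x\<in>X. T x \<in> X \<and> N (T x) \<le> C * N x)"

definition interpolation_space ::
    "'a measure \<Rightarrow> ('a \<Rightarrow> real) set \<Rightarrow> (('a \<Rightarrow> real) \<Rightarrow> real) \<Rightarrow>
     ('a \<Rightarrow> real) set \<Rightarrow> (('a \<Rightarrow> real) \<Rightarrow> real) \<Rightarrow>
     ('a \<Rightarrow> real) set \<Rightarrow> (('a \<Rightarrow> real) \<Rightarrow> real) \<Rightarrow> bool" where
  "interpolation_space M X N X0 N0 X1 N1 \<longleftrightarrow>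
     banach_function_space M X N \<and>
     X0 \<inter> X1 \<subseteq> X \<and> X \<subseteq> sum_space X0 X1 \<and>
     (\<forall>T. linear_operator M (sum_space X0 X1) T \<and> bounded_in X0 N0 T \<and> bounded_in X1 N1 T
        \<longrightarrow> bounded_in X N T)"

definition linear_span :: "(nat \<Rightarrow> 'a \<Rightarrow> real) \<Rightarrow> ('a \<Rightarrow> real) set" where
  "linear_span e = {\<lambda>t. \<Sum>n<m. a n * e n t | a m. True}"

definition closed_linear_span ::
    "('a \<Rightarrow> real) set \<Rightarrow> (('a \<Rightarrow> real) \<Rightarrow> real) \<Rightarrow> (nat \<Rightarrow> 'a \<Rightarrow> real) \<Rightarrow> ('a \<Rightarrow> real) set" where
  "closed_linear_span X N e =
     {x \<in> X. \<forall>\<epsilon>>0. \<exists>y\<in>linear_span e. N (\<lambda>t. x t - y t) < \<epsilon>}"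

definition schauder_basis ::
    "('a \<Rightarrow> real) set \<Rightarrow> (('a \<Rightarrow> real) \<Rightarrow> real) \<Rightarrow> (nat \<Rightarrow> 'a \<Rightarrow> real) \<Rightarrow> bool" where
  "schauder_basis Y N e \<longleftrightarrow>
     (\<forall>n. e n \<in> Y) \<and>
     (\<forall>x\<in>Y. \<exists>!a. (\<lambda>m. N (\<lambda>t. x t - (\<Sum>n<m. a n * e n t))) \<longlonglongrightarrow> 0)"

definition basic_sequence ::
    "('a \<Rightarrow> real) set \<Rightarrow> (('a \<Rightarrow> real) \<Rightarrow> real) \<Rightarrow> (nat \<Rightarrow> 'a \<Rightarrow> real) \<Rightarrow> bool" where
  "basic_sequence X N e \<longleftrightarrow> (\<forall>n. e n \<in> X) \<and> schauder_basis (closed_linear_span X N e) N e"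

text \<open>Rademacher functions are indexed from \<open>1\<close>; the index \<open>0\<close> is not used.\<close>

definition rademacher :: "nat \<Rightarrow> real \<Rightarrow> real" where
  "rademacher k t = sgn (sin (2 ^ (k - 1) * pi * t))"

abbreviation unit_interval :: "real measure" where
  "unit_interval \<equiv> lebesgue_on {0..1}"

end

theory Submission
  imports Defs
begin

text \<open>
  For \<open>l \<ge> 2\<close> the map \<open>t \<mapsto> t + 2 ^ (1 - l) r\<^sub>l(t)\<close> exchanges the halves of the dyadic intervals of length
  \<open>2 ^ (2 - l)\<close>. It preserves measure on \<open>[0,1]\<close>, changes the sign of \<open>r\<^sub>l\<close> and fixes all other \<open>r\<^sub>i\<close>.
  Averaging a polynomial in the Rademacher functions with its image therefore deletes the terms
  containing \<open>r\<^sub>l\<close> without increasing the norm of a symmetric space. In a partial sum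
  ending at \<open>r\<^sub>i r\<^sub>k\<^sub>+\<^sub>1\<close>, the rows before \<open>r\<^sub>k\<^sub>+\<^sub>1\<close> arise by deleting \<open>r\<^sub>k\<^sub>+\<^sub>1, r\<^sub>k\<^sub>+\<^sub>2, \<dots>\<close>. The whole row of \<open>r\<^sub>k\<^sub>+\<^sub>1\<close>
  is a difference of two such deletions, and its beginning is obtained by deleting \<open>r\<^sub>i\<^sub>+\<^sub>1, \<dots>, r\<^sub>k\<close>.
  Hence the partial sum projections have norm at most \<open>3\<close> on the linear span.
\<close>

section \<open>The basis inequality\<close>

locale function_space =
  fixes M :: "'a measure" and X :: "('a \<Rightarrow> real) set" and N :: "('a \<Rightarrow> real) \<Rightarrow> real"
  assumes banach: "banach_function_space M X N"
begin

section \<open>Norm rules for finite combinations\<close>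

lemma meas: "x \<in> X \<Longrightarrow> x \<in> borel_measurable M"
  using banach by (auto simp: banach_function_space_def)

lemma zero_mem: "(\<lambda>t. 0) \<in> X"
  using banach by (auto simp: banach_function_space_def)

lemma add_mem: "x \<in> X \<Longrightarrow> y \<in> X \<Longrightarrow> (\<lambda>t. x t + y t) \<in> X"
  using banach by (auto simp: banach_function_space_def)

lemma norm_add: "x \<in> X \<Longrightarrow> y \<in> X \<Longrightarrow> N (\<lambda>t. x t + y t) \<le> N x + N y"
  using banach by (auto simp: banach_function_space_def)

lemma scale_mem: "x \<in> X \<Longrightarrow> (\<lambda>t. c * x t) \<in> X"
  using banach by (auto simp: banach_function_space_def)

lemma norm_scale: "x \<in> X \<Longrightarrow> N (\<lambda>t. c * x t) = \<bar>c\<bar> * N x"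
  using banach by (auto simp: banach_function_space_def)

lemma norm_nonneg: "x \<in> X \<Longrightarrow> 0 \<le> N x"
  using banach by (auto simp: banach_function_space_def)

lemma norm_eq_0: "x \<in> X \<Longrightarrow> N x = 0 \<longleftrightarrow> (AE t in M. x t = 0)"
  using banach by (auto simp: banach_function_space_def)

lemma norm_zero: "N (\<lambda>t. 0) = 0"
  using norm_eq_0[OF zero_mem] by simp

lemma diff_mem: "x \<in> X \<Longrightarrow> y \<in> X \<Longrightarrow> (\<lambda>t. x t - y t) \<in> X"
  using add_mem[OF _ scale_mem[of y "-1"], of x] by simp

lemma norm_diff: "x \<in> X \<Longrightarrow> y \<in> X \<Longrightarrow> N (\<lambda>t. x t - y t) \<le> N x + N y"
  using norm_add[OF _ scale_mem[of y "-1"], of x] norm_scale[of y "-1"] by simp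

lemma norm_minus_commute: "x \<in> X \<Longrightarrow> y \<in> X \<Longrightarrow> N (\<lambda>t. x t - y t) = N (\<lambda>t. y t - x t)"
  using norm_scale[OF diff_mem[of x y], of "-1"] by simp

lemma norm_diff_triangle:
  assumes "x \<in> X" "y \<in> X" "z \<in> X"
  shows "N (\<lambda>t. x t - z t) \<le> N (\<lambda>t. x t - y t) + N (\<lambda>t. y t - z t)"
  using norm_add[OF diff_mem[OF assms(1,2)] diff_mem[OF assms(2,3)]] by simp

lemma sum_mem: "(\<And>n. n \<in> F \<Longrightarrow> e n \<in> X) \<Longrightarrow> (\<lambda>t. \<Sum>n\<in>F. a n * e n t) \<in> X"
  by (induction F rule: infinite_finite_induct) (simp_all add: zero_mem add_mem scale_mem)

lemma norm_sum:
  "(\<And>n. n \<in> F \<Longrightarrow> e n \<in> X) \<Longrightarrow> N (\<lambda>t. \<Sum>n\<in>F. a n * e n t) \<le> (\<Sum>n\<in>F. \<bar>a n\<bar> * N (e n))"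
proof (induction F rule: infinite_finite_induct)
  case (insert n F)
  have "N (\<lambda>t. a n * e n t + (\<Sum>n\<in>F. a n * e n t))
      \<le> N (\<lambda>t. a n * e n t) + N (\<lambda>t. \<Sum>n\<in>F. a n * e n t)"
    using insert.prems by (intro norm_add scale_mem sum_mem) auto
  also have "\<dots> \<le> \<bar>a n\<bar> * N (e n) + (\<Sum>n\<in>F. \<bar>a n\<bar> * N (e n))"
    using insert by (simp add: norm_scale)
  finally show ?case using insert.hyps by simp
qed (simp_all add: norm_zero)

text \<open>Grunblum's criterion. Differences of consecutive partial sums bound the coefficients,
  which gives uniqueness. For existence, finite sums approximating \<open>x\<close> have
  coefficients converging to some \<open>b\<close>. The basis inequality is uniform in the length of
  the partial sum, so the partial sums of \<open>b\<close> approximate \<open>x\<close> as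
  well.\<close>

theorem basic_sequence_if_basis_inequality:
  assumes mem: "\<And>n. e n \<in> X" and nz: "\<And>n. \<not> (AE t in M. e n t = 0)"
    and basis: "\<And>a m k. m \<le> k \<Longrightarrow>
      N (\<lambda>t. \<Sum>n<m. a n * e n t) \<le> C * N (\<lambda>t. \<Sum>n<k. a n * e n t)"
  shows "basic_sequence X N e"
proof -
  define S where "S a m = (\<lambda>t. \<Sum>n<m. a n * e n t)" for a :: "nat \<Rightarrow> real" and m :: nat
  have SX: "S a m \<in> X" for a m
    unfolding S_def by (intro sum_mem mem)
  have Sdiff: "S (\<lambda>n. a n - b n) m = (\<lambda>t. S a m t - S b m t)" for a b m
    by (auto simp: S_def sum_subtractf left_diff_distrib)
  have basis: "N (S a m) \<le> C * N (S a k)" if "m \<le> k" for a m k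
    using basis[OF that] by (simp add: S_def)
  have epos: "N (e n) > 0" for n
    using norm_nonneg[OF mem] norm_eq_0[OF mem] nz by (metis less_eq_real_def)
  have coeff: "\<bar>a n\<bar> * N (e n) \<le> 2 * C * N (S a k)" if "n < k" for a n k
  proof -
    have "(\<lambda>t. a n * e n t) = (\<lambda>t. S a (Suc n) t - S a n t)"
      by (auto simp: S_def)
    then have "\<bar>a n\<bar> * N (e n) = N (\<lambda>t. S a (Suc n) t - S a n t)"
      using norm_scale[OF mem, of "a n" n] by simp
    also have "\<dots> \<le> N (S a (Suc n)) + N (S a n)"
      by (intro norm_diff SX)
    also have "\<dots> \<le> 2 * C * N (S a k)"
      using basis[of "Suc n" k a] basis[of n k a] that by simp
    finally show ?thesis .
  qed
  have uniq: "a = b" if xX: "x \<in> X" and a: "(\<lambda>m. N (\<lambda>t. x t - S a m t)) \<longlonglongrightarrow> 0"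
    and b: "(\<lambda>m. N (\<lambda>t. x t - S b m t)) \<longlonglongrightarrow> 0" for x a b
  proof
    fix n
    let ?c = "\<lambda>n. a n - b n"
    have le: "N (S ?c k) \<le> N (\<lambda>t. x t - S a k t) + N (\<lambda>t. x t - S b k t)" for k
      using norm_diff[OF diff_mem[OF xX SX[of b k]] diff_mem[OF xX SX[of a k]]]
      by (simp add: Sdiff)
    have lim: "(\<lambda>k. N (S ?c k)) \<longlonglongrightarrow> 0"
      by (rule tendsto_sandwich[OF _ _ tendsto_const tendsto_add_zero[OF a b]])
         (auto simp: norm_nonneg SX le)
    have "(\<lambda>k. 2 * C * N (S ?c k)) \<longlonglongrightarrow> 2 * C * 0"
      by (intro tendsto_intros lim)
    moreover have "eventually (\<lambda>k. \<bar>?c n\<bar> * N (e n) \<le> 2 * C * N (S ?c k)) sequentially"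
      using eventually_gt_at_top[of n] by eventually_elim (rule coeff)
    \<comment> \<open>The left side does not depend on \<open>k\<close>, so it is at most the limit
      of the right side.\<close>
    ultimately have "\<bar>?c n\<bar> * N (e n) \<le> 2 * C * 0"
      by (intro tendsto_lowerbound) auto
    then show "a n = b n"
      using epos[of n] by (simp add: mult_le_0_iff)
  qed
  have ex: "\<exists>a. (\<lambda>m. N (\<lambda>t. x t - S a m t)) \<longlonglongrightarrow> 0"
    if x: "x \<in> closed_linear_span X N e" for x
  proof -
    have xX: "x \<in> X" using x by (simp add: closed_linear_span_def)
    have "\<exists>a m. (\<forall>n\<ge>m. a n = 0) \<and> N (\<lambda>t. x t - S a m t) < inverse (real (Suc k))" for k
    proof -
      have "0 < inverse (real (Suc k))" by simp
      then have "\<exists>y\<in>linear_span e. N (\<lambda>t. x t - y t) < inverse (real (Suc k))"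
        using x unfolding closed_linear_span_def by blast
      then obtain y where y: "y \<in> linear_span e"
        and less: "N (\<lambda>t. x t - y t) < inverse (real (Suc k))" by blast
      obtain a m where am: "y = (\<lambda>t. \<Sum>n<m. a n * e n t)"
        using y by (auto simp: linear_span_def)
      \<comment> \<open>Padding with zeros turns the approximant into a full coefficient sequence
        whose partial sums are constant from \<open>m\<close> on.\<close>
      let ?a = "\<lambda>n. if n < m then a n else 0"
      have "S ?a m = y"
        unfolding S_def am by (intro ext sum.cong refl) simp
      then have "(\<forall>n\<ge>m. ?a n = 0) \<and> N (\<lambda>t. x t - S ?a m t) < inverse (real (Suc k))"
        using less by simp
      then show ?thesis by (intro exI[of _ ?a] exI[of _ m])
    qed
    then obtain A L where A0: "\<And>k n. n \<ge> L k \<Longrightarrow> A k n = 0"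
      and Ax: "\<And>k. N (\<lambda>t. x t - S (A k) (L k) t) < inverse (real (Suc k))"
      by metis
    have stab: "S (A k) m = S (A k) (L k)" if "m \<ge> L k" for k m
      unfolding S_def using that A0 by (intro ext sum.mono_neutral_right) auto
    have close: "N (S (\<lambda>n. A k n - A l n) m) \<le> inverse (real (Suc k)) + inverse (real (Suc l))"
      if "m \<ge> L k" "m \<ge> L l" for k l m
    proof -
      have "N (\<lambda>t. S (A k) m t - S (A l) m t)
          \<le> N (\<lambda>t. S (A k) m t - x t) + N (\<lambda>t. x t - S (A l) m t)"
        by (intro norm_diff_triangle SX xX)
      also have "N (\<lambda>t. S (A k) m t - x t) = N (\<lambda>t. x t - S (A k) m t)"
        by (intro norm_minus_commute SX xX)
      finally show ?thesis
        using Ax[of k] Ax[of l] by (simp add: Sdiff stab[OF that(1)] stab[OF that(2)])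
    qed
    \<comment> \<open>The sign of \<open>C\<close> follows from the inequality itself, applied to
      the single nonzero term \<open>e 0\<close>.\<close>
    have C0: "C \<ge> 0"
    proof -
      have "0 < N (S (\<lambda>_. 1) 1)" using epos[of 0] by (simp add: S_def)
      then show ?thesis using basis[of 1 1 "\<lambda>_. 1"]
          zero_less_mult_iff[of C "N (S (\<lambda>_. 1) 1)"] by linarith
    qed
    have close': "N (S (\<lambda>n. A k n - A l n) m) \<le> C * (inverse (real (Suc k)) + inverse (real (Suc l)))"
      for k l m
    proof -
      \<comment> \<open>At length \<open>p\<close> both sums are complete, so both are close to
        \<open>x\<close>; the basis inequality carries the estimate down to every
        \<open>m\<close>.\<close>
      define p where "p = max m (max (L k) (L l))"
      have "N (S (\<lambda>n. A k n - A l n) m) \<le> C * N (S (\<lambda>n. A k n - A l n) p)"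
        by (rule basis) (simp add: p_def)
      also have "\<dots> \<le> C * (inverse (real (Suc k)) + inverse (real (Suc l)))"
        by (intro mult_left_mono close C0) (auto simp: p_def)
      finally show ?thesis .
    qed
    have "Cauchy (\<lambda>k. A k n)" for n
    proof (rule metric_CauchyI)
      fix \<epsilon> :: real assume "\<epsilon> > 0"
      \<comment> \<open>The estimate below yields \<open>4 * C * C * \<delta>\<close>. The
        denominator is chosen to exceed \<open>4 * C * C\<close> strictly and to stay positive when
        \<open>C = 0\<close>.\<close>
      define \<delta> where "\<delta> = \<epsilon> * N (e n) / (4 * (C * (C + 1)) + 1)"
      have d: "\<delta> > 0" using \<open>\<epsilon> > 0\<close> epos[of n] C0
        by (auto simp: \<delta>_def intro!: divide_pos_pos add_nonneg_pos)
      obtain K where K: "inverse (real (Suc K)) < \<delta>"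
        using reals_Archimedean[OF d] by auto
      have "dist (A k n) (A l n) < \<epsilon>" if "k \<ge> K" "l \<ge> K" for k l
      proof -
        have "inverse (real (Suc j)) \<le> \<delta>" if "j \<ge> K" for j
          using le_imp_inverse_le[of "real (Suc K)" "real (Suc j)"] that K by linarith
        note inv = this[OF that(1)] this[OF that(2)]
        have "\<bar>A k n - A l n\<bar> * N (e n) \<le> 2 * C * N (S (\<lambda>n. A k n - A l n) (Suc n))"
          by (rule coeff) simp
        also have "\<dots> \<le> 2 * C * (C * (\<delta> + \<delta>))"
          using C0 inv by (intro mult_left_mono order_trans[OF close'] add_mono) auto
        also have "\<dots> < (4 * (C * (C + 1)) + 1) * \<delta>"
          using C0 d by (simp add: algebra_simps add_pos_nonneg)
        also have "\<dots> = \<epsilon> * N (e n)"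
          using C0 by (simp add: \<delta>_def add_nonneg_eq_0_iff)
        finally show ?thesis using epos[of n] by (simp add: dist_real_def)
      qed
      then show "\<exists>K. \<forall>k\<ge>K. \<forall>l\<ge>K. dist (A k n) (A l n) < \<epsilon>" by blast
    qed
    then have "\<exists>b. (\<lambda>k. A k n) \<longlonglongrightarrow> b" for n
      by (simp add: Cauchy_convergent_iff convergent_def)
    then obtain b where b: "\<And>n. (\<lambda>k. A k n) \<longlonglongrightarrow> b n" by metis
    \<comment> \<open>Let \<open>l\<close> tend to infinity with \<open>k\<close> and
      \<open>m\<close> fixed: only finitely many coefficients occur, so their convergence gives
      convergence in norm, and the bound stays independent of \<open>m\<close>.\<close>
    have lim: "N (S (\<lambda>n. A k n - b n) m) \<le> C * inverse (real (Suc k))" for k m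
    proof -
      have 1: "(\<lambda>l. \<Sum>n<m. \<bar>A l n - b n\<bar> * N (e n)) \<longlonglongrightarrow> (\<Sum>n<m. \<bar>b n - b n\<bar> * N (e n))"
        by (intro tendsto_intros b)
      have 2: "(\<lambda>l. C * (inverse (real (Suc k)) + inverse (real (Suc l))))
          \<longlonglongrightarrow> C * (inverse (real (Suc k)) + 0)"
        by (intro tendsto_intros LIMSEQ_inverse_real_of_nat)
      have "N (S (\<lambda>n. A k n - b n) m) \<le> C * (inverse (real (Suc k)) + inverse (real (Suc l)))
          + (\<Sum>n<m. \<bar>A l n - b n\<bar> * N (e n))" for l
      proof -
        have "N (S (\<lambda>n. A k n - b n) m)
            \<le> N (S (\<lambda>n. A k n - A l n) m) + N (S (\<lambda>n. A l n - b n) m)"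
          unfolding Sdiff by (intro norm_diff_triangle SX)
        moreover have "N (S (\<lambda>n. A l n - b n) m) \<le> (\<Sum>n<m. \<bar>A l n - b n\<bar> * N (e n))"
          unfolding S_def by (intro norm_sum mem)
        ultimately show ?thesis using close'[of k l m] by linarith
      qed
      then show ?thesis
        using tendsto_lowerbound[OF tendsto_add[OF 2 1]] by simp
    qed
    have bound: "N (\<lambda>t. x t - S b m t) \<le> (C + 1) * inverse (real (Suc k))" if "m \<ge> L k" for k m
    proof -
      have "N (\<lambda>t. x t - S b m t)
          \<le> N (\<lambda>t. x t - S (A k) m t) + N (\<lambda>t. S (A k) m t - S b m t)"
        by (intro norm_diff_triangle SX xX)
      also have "\<dots> \<le> inverse (real (Suc k)) + C * inverse (real (Suc k))"
        using Ax[of k] lim[of k m] by (simp add: Sdiff stab[OF that])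
      finally show ?thesis by (simp add: algebra_simps)
    qed
    have "(\<lambda>m. N (\<lambda>t. x t - S b m t)) \<longlonglongrightarrow> 0"
    proof (rule LIMSEQ_I)
      fix \<epsilon> :: real assume "\<epsilon> > 0"
      then have "\<epsilon> / (C + 1) > 0" using C0 by simp
      then obtain k where "inverse (real (Suc k)) < \<epsilon> / (C + 1)"
        using reals_Archimedean by blast
      then have "(C + 1) * inverse (real (Suc k)) < \<epsilon>"
        using C0 by (simp add: field_simps)
      then have "norm (N (\<lambda>t. x t - S b m t) - 0) < \<epsilon>" if "m \<ge> L k" for m
        using bound[OF that] norm_nonneg[OF diff_mem[OF xX SX[of b m]]] by simp
      then show "\<exists>no. \<forall>m\<ge>no. norm (N (\<lambda>t. x t - S b m t) - 0) < \<epsilon>" by blast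
    qed
    then show ?thesis by blast
  qed
  have "e n \<in> closed_linear_span X N e" for n
  proof -
    have "e n = (\<lambda>t. \<Sum>i<Suc n. (if i = n then 1 else 0) * e i t)"
      by (simp add: if_distrib[of "\<lambda>c. c * _"] cong: if_cong)
    then have "e n \<in> linear_span e"
      unfolding linear_span_def
      by (intro CollectI exI[of _ "\<lambda>i. if i = n then 1 else 0"] exI[of _ "Suc n"]) simp
    moreover have "N (\<lambda>t. e n t - e n t) = 0" by (simp add: norm_zero)
    ultimately show ?thesis using mem by (auto simp: closed_linear_span_def intro!: bexI[of _ "e n"])
  qed
  then show ?thesis
    unfolding basic_sequence_def schauder_basis_def
    using mem ex uniq unfolding S_def closed_linear_span_def by blast
qed

end

section \<open>Flipping the sign of a single Rademacher function\<close>

context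
  notes One_nat_def [simp del]
begin

section \<open>Rademacher functions as parities of floors\<close>

lemma sgn_sin_pi:
  assumes "v \<notin> \<int>"
  shows "sgn (sin (pi * v)) = (if even \<lfloor>v\<rfloor> then 1 else - 1)"
proof -
  have "frac v > 0" using assms by (simp add: frac_gt_0_iff)
  then have "sin (pi * frac v) > 0"
    by (intro sin_gt_zero) (auto simp: frac_lt_1)
  moreover have "sin (pi * v) = sin (pi * frac v) * cos (pi * \<lfloor>v\<rfloor>)"
  proof -
    have "pi * v = pi * frac v + pi * \<lfloor>v\<rfloor>" by (simp add: frac_def algebra_simps)
    then show ?thesis by (simp add: sin_add sin_int_times_real mult.commute)
  qed
  ultimately show ?thesis by (auto simp: cos_int_times_real sgn_mult mult.commute)
qed

text \<open>Off the dyadic grid of level \<open>l\<close>, the single integer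
  \<open>\<lfloor>2 ^ (l - 1) * t\<rfloor>\<close> determines all of
  \<open>r\<^sub>1, ..., r\<^sub>l\<close> through its binary digits, because dropping the last
  \<open>l - i\<close> digits leaves \<open>\<lfloor>2 ^ (i - 1) * t\<rfloor>\<close>.\<close>

lemma rademacher_eq_floor:
  assumes "1 \<le> i" "i \<le> l" and u: "2 ^ (l - 1) * t \<notin> \<int>"
  shows "rademacher i t = (if even (\<lfloor>2 ^ (l - 1) * t\<rfloor> div 2 ^ (l - i)) then 1 else - 1)"
proof -
  let ?u = "2 ^ (l - 1) * t"
  have pow: "(2::real) ^ (l - 1) = 2 ^ (i - 1) * 2 ^ (l - i)"
    using assms(1,2) by (simp flip: power_add)
  then have v: "2 ^ (i - 1) * t = ?u / 2 ^ (l - i)" by simp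
  have "2 ^ (i - 1) * t \<notin> \<int>"
  proof
    assume "2 ^ (i - 1) * t \<in> \<int>"
    then have "2 ^ (l - i) * (2 ^ (i - 1) * t) \<in> \<int>" by (intro Ints_mult[of "2 ^ (l - i)"]) auto
    then show False using u pow by (simp add: mult_ac)
  qed
  then have "rademacher i t = (if even \<lfloor>?u / 2 ^ (l - i)\<rfloor> then 1 else - 1)"
    using sgn_sin_pi[of "2 ^ (i - 1) * t"] unfolding v[symmetric] by (simp add: rademacher_def mult_ac)
  moreover have "\<lfloor>?u / 2 ^ (l - i)\<rfloor> = \<lfloor>?u\<rfloor> div 2 ^ (l - i)"
    using floor_divide_real_eq_div[of "2 ^ (l - i)" ?u] by simp
  ultimately show ?thesis by simp
qed

lemma rademacher_eq_0_iff:
  assumes "1 \<le> l"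
  shows "rademacher l t = 0 \<longleftrightarrow> 2 ^ (l - 1) * t \<in> \<int>"
proof
  assume "rademacher l t = 0"
  then show "2 ^ (l - 1) * t \<in> \<int>"
    using rademacher_eq_floor[of l l t] assms by (cases "2 ^ (l - 1) * t \<in> \<int>") (auto split: if_splits)
next
  assume "2 ^ (l - 1) * t \<in> \<int>"
  then have "sin (2 ^ (l - 1) * t * pi) = 0" by (simp add: sin_times_pi_eq_0)
  then show "rademacher l t = 0" by (simp add: rademacher_def mult_ac)
qed

lemma rademacher_measurable: "rademacher i \<in> borel_measurable borel"
  unfolding rademacher_def sgn_real_def by measurable

lemma rademacher_measurable_unit: "rademacher i \<in> borel_measurable unit_interval"
  using rademacher_measurable
  by (intro measurable_restrict_space1) (auto intro: measurable_completion)

lemma AE_rademacher_abs: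
  assumes "1 \<le> i"
  shows "AE t in unit_interval. \<bar>rademacher i t\<bar> = 1"
proof -
  let ?Z = "(\<lambda>z. of_int z / 2 ^ (i - 1)) ` (UNIV :: int set) :: real set"
  have "?Z \<in> null_sets lebesgue"
    by (intro null_sets_completionI countable_imp_null_set_lborel) auto
  then have "AE t in lebesgue. t \<notin> ?Z" by (rule AE_not_in)
  then have "AE t in lebesgue. t \<in> {0..1} \<longrightarrow> \<bar>rademacher i t\<bar> = 1"
  proof eventually_elim
    case (elim t)
    have "2 ^ (i - 1) * t \<notin> \<int>"
    proof
      assume "2 ^ (i - 1) * t \<in> \<int>"
      then obtain z where "2 ^ (i - 1) * t = of_int z" by (auto elim: Ints_cases)
      then have "t = of_int z / 2 ^ (i - 1)" by (simp add: field_simps)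
      then show False using elim by auto
    qed
    then show ?case using rademacher_eq_floor[of i i t] assms by simp
  qed
  then show ?thesis by (simp add: AE_restrict_space_iff)
qed

section \<open>The flip and its action on the Rademacher functions\<close>

text \<open>Grid points, where \<open>rademacher l\<close> is \<open>0\<close>, are fixed. Hence the
  identities below hold at every point and not merely almost everywhere.\<close>

definition flip :: "nat \<Rightarrow> real \<Rightarrow> real" where
  "flip l t = t + rademacher l t / 2 ^ (l - 1)"

lemma rademacher_cases: "rademacher l t = - 1 \<or> rademacher l t = 0 \<or> rademacher l t = 1"
  by (auto simp: rademacher_def sgn_real_def)

lemma scaled_flip: "2 ^ (l - 1) * flip l t = 2 ^ (l - 1) * t + rademacher l t"
  by (simp add: flip_def distrib_left)

lemma scaled_flip_Ints_iff: "2 ^ (l - 1) * flip l t \<in> \<int> \<longleftrightarrow> 2 ^ (l - 1) * t \<in> \<int>"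
  using rademacher_cases[of l t] by (auto simp: scaled_flip)

text \<open>In units of \<open>2 ^ (1 - l)\<close> the flip is a step of length one that exchanges
  \<open>2 * j\<close> and \<open>2 * j + 1\<close>, that is, it toggles the last binary
  digit.\<close>

lemma floor_scaled_flip:
  assumes "1 \<le> l" "2 ^ (l - 1) * t \<notin> \<int>"
  shows "\<lfloor>2 ^ (l - 1) * flip l t\<rfloor> = (if even \<lfloor>2 ^ (l - 1) * t\<rfloor>
    then \<lfloor>2 ^ (l - 1) * t\<rfloor> + 1 else \<lfloor>2 ^ (l - 1) * t\<rfloor> - 1)"
proof -
  have "rademacher l t = of_int (if even \<lfloor>2 ^ (l - 1) * t\<rfloor> then 1 else - 1)"
    using rademacher_eq_floor[of l l t] assms by simp
  then show ?thesis unfolding scaled_flip by (simp only: floor_add_int[symmetric]) simp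
qed

lemma rademacher_flip_same:
  assumes "1 \<le> l"
  shows "rademacher l (flip l t) = - rademacher l t"
proof (cases "2 ^ (l - 1) * t \<in> \<int>")
  case True
  then show ?thesis
    using rademacher_eq_0_iff[OF assms, of t] rademacher_eq_0_iff[OF assms, of "flip l t"]
      scaled_flip_Ints_iff[of l t] by simp
next
  case False
  have "rademacher l t = (if even \<lfloor>2 ^ (l - 1) * t\<rfloor> then 1 else - 1)"
    using rademacher_eq_floor[of l l t] assms False by simp
  moreover have "rademacher l (flip l t) = (if even \<lfloor>2 ^ (l - 1) * flip l t\<rfloor> then 1 else - 1)"
    using rademacher_eq_floor[of l l "flip l t"] assms False scaled_flip_Ints_iff[of l t] by simp
  ultimately show ?thesis using floor_scaled_flip[OF assms False] by simp
qed

lemma flip_flip: "1 \<le> l \<Longrightarrow> flip l (flip l t) = t"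
  using rademacher_flip_same[of l t] by (simp add: flip_def[of l "flip l t"]) (simp add: flip_def)

text \<open>The values for \<open>i < l\<close> depend only on the digits above the last one, and
  these survive the toggling.\<close>

lemma rademacher_flip_less:
  assumes "1 \<le> i" "i < l"
  shows "rademacher i (flip l t) = rademacher i t"
proof (cases "2 ^ (l - 1) * t \<in> \<int>")
  case True
  then show ?thesis
    using rademacher_eq_0_iff[of l t] assms by (simp add: flip_def)
next
  case False
  let ?u = "2 ^ (l - 1) * t"
  have "l - i = Suc (l - i - 1)" using assms by simp
  then have pow: "(2::int) ^ (l - i) = 2 * 2 ^ (l - i - 1)" by (metis power_Suc)
  have "\<lfloor>2 ^ (l - 1) * flip l t\<rfloor> = (if even \<lfloor>?u\<rfloor> then \<lfloor>?u\<rfloor> + 1 else \<lfloor>?u\<rfloor> - 1)"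
    using floor_scaled_flip[of l t] assms False by simp
  then have "\<lfloor>2 ^ (l - 1) * flip l t\<rfloor> div 2 = \<lfloor>?u\<rfloor> div 2" by auto presburger
  then have "\<lfloor>2 ^ (l - 1) * flip l t\<rfloor> div 2 ^ (l - i) = \<lfloor>?u\<rfloor> div 2 ^ (l - i)"
    unfolding pow by (simp add: zdiv_zmult2_eq)
  then show ?thesis
    using rademacher_eq_floor[of i l t] rademacher_eq_floor[of i l "flip l t"]
      assms False scaled_flip_Ints_iff[of l t] by simp
qed

text \<open>The displacement is an integer multiple of \<open>2 ^ (1 - l)\<close>, hence of the
  period of the sine defining \<open>rademacher i\<close>.\<close>

lemma rademacher_flip_greater:
  assumes "1 \<le> l" "l < i"
  shows "rademacher i (flip l t) = rademacher i t"
proof -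
  have "i - 1 = (l - 1) + Suc (i - l - 1)" using assms by simp
  then have pow: "(2::real) ^ (i - 1) = 2 ^ (l - 1) * (2 * 2 ^ (i - l - 1))"
    by (metis power_add power_Suc)
  obtain s :: int where s: "rademacher l t = of_int s"
    using rademacher_cases[of l t] by (metis of_int_0 of_int_1 of_int_minus)
  have "2 ^ (i - 1) * pi * flip l t
      = 2 ^ (i - 1) * pi * t + 2 * of_int (2 ^ (i - l - 1) * s) * pi"
    by (simp add: flip_def s pow distrib_left distrib_right mult_ac)
  then have "sin (2 ^ (i - 1) * pi * flip l t) = sin (2 ^ (i - 1) * pi * t)"
    using cos_int_2pin[of "2 ^ (i - l - 1) * s"] sin_int_2pin[of "2 ^ (i - l - 1) * s"]
    by (simp only: sin_add) (simp add: mult_ac)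
  then show ?thesis by (simp add: rademacher_def)
qed

lemma rademacher_flip:
  "1 \<le> l \<Longrightarrow> 1 \<le> i \<Longrightarrow> rademacher i (flip l t) = (if i = l then - rademacher i t else rademacher i t)"
  using rademacher_flip_same rademacher_flip_less rademacher_flip_greater
  by (metis linorder_neqE_nat)

text \<open>This needs \<open>2 \<le> l\<close>, since \<open>rademacher 1\<close> is \<open>1\<close> on the whole interval.\<close>

lemma flip_mem_unit_interval:
  assumes l: "2 \<le> l" and t: "t \<in> {0..1}"
  shows "flip l t \<in> {0..1}"
proof (cases "2 ^ (l - 1) * t \<in> \<int>")
  case True
  then show ?thesis
    using rademacher_eq_0_iff[of l t] assms by (simp add: flip_def)
next
  case False
  let ?u = "2 ^ (l - 1) * t"
  let ?P = "2 ^ (l - 1) :: int"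
  have "even ?P" using l by simp
  have r: "rademacher l t = (if even \<lfloor>?u\<rfloor> then 1 else - 1)"
    using rademacher_eq_floor[of l l t] assms False by simp
  have "0 \<le> ?u" "?u \<le> 2 ^ (l - 1)" using t by (auto simp: mult_left_le)
  moreover have "?u \<noteq> of_int ?P" using False by (metis Ints_of_int)
  ultimately have f: "0 \<le> \<lfloor>?u\<rfloor>" "\<lfloor>?u\<rfloor> < ?P"
    by (auto simp: floor_less_iff)
  have "0 \<le> 2 ^ (l - 1) * flip l t \<and> 2 ^ (l - 1) * flip l t \<le> 2 ^ (l - 1)"
  proof (cases "even \<lfloor>?u\<rfloor>")
    case True
    \<comment> \<open>Here \<open>2 \<le> l\<close> enters: \<open>?P\<close> is even, so an even
      floor below it is at most \<open>?P - 2\<close>, which leaves room for the upward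
      step.\<close>
    have "n + 2 \<le> p" if "even n" "even p" "n < p" for n p :: int
      using that by presburger
    from this[OF True \<open>even ?P\<close> f(2)]
    have "of_int (\<lfloor>?u\<rfloor> + 2) \<le> (of_int ?P :: real)" by (simp only: of_int_le_iff)
    then have "?u + 1 \<le> 2 ^ (l - 1)" by simp linarith
    then show ?thesis using True r \<open>0 \<le> ?u\<close> by (simp add: scaled_flip)
  next
    case odd: False
    then have "1 \<le> \<lfloor>?u\<rfloor>" using f by presburger
    then have "1 \<le> ?u" by (simp add: le_floor_iff)
    moreover have "2 ^ (l - 1) * flip l t = ?u - 1" using odd r by (simp add: scaled_flip)
    ultimately show ?thesis using \<open>?u \<le> 2 ^ (l - 1)\<close> by linarith
  qed
  then show ?thesis
    using mult_le_cancel_left_pos[of "2 ^ (l - 1)" 0 "flip l t"]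
      mult_le_cancel_left_pos[of "2 ^ (l - 1)" "flip l t" 1] by simp
qed

text \<open>On each of the three level sets of \<open>rademacher l\<close> the flip is a
  translation, so translation invariance of Lebesgue measure applies piece by piece.\<close>

lemma equimeasurable_flip:
  assumes l: "2 \<le> l" and f: "f \<in> borel_measurable unit_interval"
    and g: "g \<in> borel_measurable unit_interval"
    and gf: "\<And>t. g t = f (flip l t)"
  shows "equimeasurable unit_interval g f"
  unfolding equimeasurable_def
proof
  fix \<tau> :: real
  let ?h = "1 / 2 ^ (l - 1) :: real"
  let ?B = "{t \<in> space unit_interval. f t > \<tau>}"
  let ?C = "\<lambda>s. {t \<in> ?B. rademacher l t = s}"
  let ?D = "\<lambda>s. {t \<in> {t \<in> space unit_interval. g t > \<tau>}. rademacher l t = s}"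
  have fg: "f t = g (flip l t)" for t using gf[of "flip l t"] flip_flip[of l t] l by simp
  have trans: "emeasure lebesgue ((\<lambda>t. t + c) ` S) = emeasure lebesgue S" for c :: real and S
    using emeasure_lebesgue_affine[of 1 c S] by (simp add: add.commute)
  have sets: "{t \<in> {t \<in> space unit_interval. k t > \<tau>}. rademacher l t = s} \<in> sets unit_interval"
    if "k \<in> borel_measurable unit_interval" for k s
    using that rademacher_measurable_unit[of l] by measurable
  then have sets': "{t \<in> {t \<in> space unit_interval. k t > \<tau>}. rademacher l t = s} \<in> sets lebesgue"
    if "k \<in> borel_measurable unit_interval" for k s
    using sets[OF that, of s] by (subst (asm) sets_restrict_space_iff) auto
  have split: "emeasure unit_interval {t \<in> space unit_interval. k t > \<tau>}
      = (\<Sum>s\<in>{- 1, 0, 1}. emeasure lebesgue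
          {t \<in> {t \<in> space unit_interval. k t > \<tau>}. rademacher l t = s})"
    if k: "k \<in> borel_measurable unit_interval" for k
  proof -
    let ?E = "\<lambda>s. {t \<in> {t \<in> space unit_interval. k t > \<tau>}. rademacher l t = s}"
    have "emeasure unit_interval {t \<in> space unit_interval. k t > \<tau>}
        = emeasure lebesgue {t \<in> space unit_interval. k t > \<tau>}"
      by (rule emeasure_restrict_space) auto
    also have "\<dots> = emeasure lebesgue (\<Union>s\<in>{- 1, 0, 1}. ?E s)"
      using rademacher_cases[of l] by (intro arg_cong[of _ _ "emeasure lebesgue"]) auto
    also have "\<dots> = (\<Sum>s\<in>{- 1, 0, 1}. emeasure lebesgue (?E s))"
      using sets'[OF k]
      by (intro sum_emeasure[symmetric]) (auto simp: disjoint_family_on_def)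
    finally show ?thesis .
  qed
  \<comment> \<open>The flip negates \<open>rademacher l\<close>, so the piece of \<open>f\<close>
    at value \<open>s\<close> corresponds to the piece of \<open>g\<close> at value
    \<open>- s\<close>.\<close>
  have "?D (- s) = (\<lambda>t. t + s * ?h) ` ?C s" for s
  proof (intro equalityI subsetI)
    fix t assume t: "t \<in> ?D (- s)"
    have "flip l t \<in> ?C s"
      using t l gf[of t] flip_mem_unit_interval[OF l] rademacher_flip_same[of l t] by auto
    moreover have "t = flip l t + s * ?h" using t by (simp add: flip_def)
    ultimately show "t \<in> (\<lambda>t. t + s * ?h) ` ?C s" by blast
  next
    fix t assume "t \<in> (\<lambda>t. t + s * ?h) ` ?C s"
    then obtain u where u: "u \<in> ?C s" "t = u + s * ?h" by blast
    then have "t = flip l u" by (simp add: flip_def)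
    then show "t \<in> ?D (- s)"
      using u(1) l fg[of u] flip_mem_unit_interval[OF l] rademacher_flip_same[of l u] by auto
  qed
  then have "emeasure lebesgue (?D (- s)) = emeasure lebesgue (?C s)" for s
    by (simp only: trans)
  note this[of 1] this[of 0] this[of "- 1"]
  moreover have "(\<Sum>s\<in>{- 1, 0, 1}. G s) = G (- 1) + G 0 + G 1" for G :: "real \<Rightarrow> ennreal"
    by (simp add: add_ac)
  ultimately show "emeasure unit_interval {t \<in> space unit_interval. g t > \<tau>} = emeasure unit_interval ?B"
    unfolding split[OF f] split[OF g] by (simp only: minus_minus minus_zero add_ac)
qed

end

section \<open>Rademacher chaos in a symmetric space\<close>

text \<open>Indices are deleted one at a time, each by averaging over a flip. The restriction
  \<open>L \<subseteq> {2..}\<close> ensures that these flips preserve \<open>[0,1]\<close>.\<close>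

lemma chaos_contraction:
  fixes u v :: "'i \<Rightarrow> nat"
  assumes symm: "symmetric_space unit_interval X N"
    and mem: "\<And>i j. (\<lambda>t. rademacher i t * rademacher j t) \<in> X"
    and uv: "\<And>n. n \<in> F \<Longrightarrow> 1 \<le> u n \<and> 1 \<le> v n \<and> u n \<noteq> v n"
    and F: "finite F" and L: "finite L" "L \<subseteq> {2..}"
  shows "N (\<lambda>t. \<Sum>n\<in>{n \<in> F. u n \<notin> L \<and> v n \<notin> L}. a n * (rademacher (u n) t * rademacher (v n) t))
    \<le> N (\<lambda>t. \<Sum>n\<in>F. a n * (rademacher (u n) t * rademacher (v n) t))"
  using L
proof (induction L rule: finite_induct)
  case empty
  then show ?case by simp
next
  case (insert l L)
  interpret function_space unit_interval X N
    using symm by unfold_locales (simp add: symmetric_space_def)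
  let ?w = "\<lambda>n t. rademacher (u n) t * rademacher (v n) t"
  define P where "P A = (\<lambda>t. \<Sum>n\<in>A. a n * ?w n t)" for A
  have PX: "P A \<in> X" for A
    unfolding P_def by (intro sum_mem mem)
  let ?A = "{n \<in> F. u n \<notin> L \<and> v n \<notin> L}"
  let ?B = "{n \<in> F. u n \<notin> insert l L \<and> v n \<notin> insert l L}"
  have l: "2 \<le> l" using insert.prems by simp
  \<comment> \<open>\<open>?B\<close> collects the terms without \<open>r\<^sub>l\<close>, and
    \<open>?A - ?B\<close> those containing it. Their sum \<open>f\<close> and difference
    \<open>g\<close> are exchanged by the flip, and \<open>f + g\<close> is twice the part to be
    kept.\<close>
  define f where "f = (\<lambda>t. P ?B t + P (?A - ?B) t)"
  define g where "g = (\<lambda>t. P ?B t - P (?A - ?B) t)"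
  have fX: "f \<in> X" and gX: "g \<in> X"
    unfolding f_def g_def by (intro add_mem diff_mem PX)+
  have f: "f = P ?A"
    unfolding f_def P_def using F
    by (intro ext) (subst add.commute, intro sum.subset_diff[symmetric]; auto)
  \<comment> \<open>As \<open>u n\<close> and \<open>v n\<close> differ, at most one factor of the
    product changes sign.\<close>
  have w: "?w n (flip l t) = (if u n = l \<or> v n = l then - ?w n t else ?w n t)" if "n \<in> F" for n t
    using uv[OF that] l by (auto simp: rademacher_flip)
  have "P ?B (flip l t) = P ?B t" "P (?A - ?B) (flip l t) = - P (?A - ?B) t" for t
    unfolding P_def sum_negf[symmetric] by (intro sum.cong; auto simp: w)+
  then have gf: "g t = f (flip l t)" for t
    by (simp add: f_def g_def)
  have "equimeasurable unit_interval (\<lambda>t. \<bar>g t\<bar>) (\<lambda>t. \<bar>f t\<bar>)"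
    using meas[OF fX] meas[OF gX]
    by (intro equimeasurable_flip[OF l] borel_measurable_abs arg_cong[OF gf, of abs])
  then have "N g = N f"
    using symm fX meas[OF gX] unfolding symmetric_space_def by blast
  moreover have "2 * N (P ?B) = N (\<lambda>t. f t + g t)"
    using norm_scale[OF PX[of ?B], of 2] by (simp add: f_def g_def)
  ultimately have "N (P ?B) \<le> N (P ?A)"
    using norm_add[OF fX gX] f by simp
  also have "\<dots> \<le> N (P F)"
    using insert unfolding P_def by simp
  finally show ?case unfolding P_def .
qed

section \<open>Rows and positions in the triangular enumeration\<close>

lemma triangular_index_exists:
  "\<exists>k i. 1 \<le> i \<and> i \<le> k \<and> Suc n = k * (k - 1) div 2 + i"
proof (induction n)
  case 0
  then show ?case by (intro exI[of _ 1]) simp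
next
  case (Suc n)
  then obtain k i where ki: "1 \<le> i" "i \<le> k" "Suc n = k * (k - 1) div 2 + i" by blast
  show ?case
  proof (cases "i = k")
    case True
    have "Suc k * (Suc k - 1) = k * (k - 1) + k * 2"
      by (cases k) (simp_all add: algebra_simps)
    then have "Suc k * (Suc k - 1) div 2 = k * (k - 1) div 2 + k"
      by (metis div_mult_self1 zero_neq_numeral add.commute)
    then show ?thesis using ki True by (intro exI[of _ "Suc k"] exI[of _ 1]) simp
  next
    case False
    then show ?thesis using ki by (intro exI[of _ k] exI[of _ "Suc i"]) simp
  qed
qed

text \<open>Row \<open>k\<close> ends at \<open>(k + 1) * k div 2\<close>, exactly the offset of row
  \<open>k + 1\<close>. The enumeration is therefore lexicographic in row and position.\<close>

lemma triangular_less: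
  fixes k k' i i' :: nat
  assumes "1 \<le> i'" "i \<le> k" "k < k'"
  shows "k * (k - 1) div 2 + i < k' * (k' - 1) div 2 + i'"
proof -
  have "k * (k - 1) div 2 + k = (k + 1) * k div 2"
    by (cases k) (simp_all add: algebra_simps)
  also have "(k + 1) * k \<le> k' * (k' - 1)"
    using assms(3) by (intro mult_mono) auto
  then have "(k + 1) * k div 2 \<le> k' * (k' - 1) div 2" by (rule div_le_mono)
  finally show ?thesis using assms by linarith
qed

section \<open>The basis inequality for the chaos\<close>

theorem theorem1:
  fixes X :: "(real \<Rightarrow> real) set"
    and N :: "(real \<Rightarrow> real) \<Rightarrow> real"
    and \<phi> :: "nat \<Rightarrow> real \<Rightarrow> real"
  assumes symm: "symmetric_space unit_interval X N"
    and interp: "interpolation_space unit_interval X N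
                   (L1_space unit_interval) (L1_norm unit_interval)
                   (Linf_space unit_interval) (Linf_norm unit_interval)"
    and enum: "\<And>k i. 1 \<le> k \<Longrightarrow> 1 \<le> i \<Longrightarrow> i \<le> k \<Longrightarrow>
                 \<phi> (k * (k - 1) div 2 + i) = (\<lambda>t. rademacher i t * rademacher (k + 1) t)"
  shows "basic_sequence X N (\<lambda>n. \<phi> (Suc n))"
proof -
  interpret function_space unit_interval X N
    using symm by unfold_locales (simp add: symmetric_space_def)
  interpret finite_measure unit_interval
    by (intro finite_measureI) (simp add: emeasure_restrict_space)
  have mem: "(\<lambda>t. rademacher i t * rademacher j t) \<in> X" for i j
  proof -
    let ?f = "\<lambda>t. rademacher i t * rademacher j t"
    have m: "?f \<in> borel_measurable unit_interval"
      by (intro borel_measurable_times rademacher_measurable_unit)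
    have b: "\<bar>?f t\<bar> \<le> 1" for t
      using rademacher_cases[of i t] rademacher_cases[of j t] by auto
    \<comment> \<open>Bounded functions on a finite measure space lie in both end spaces, and the
      interpolation hypothesis puts the intersection of these into \<open>X\<close>.\<close>
    have "integrable unit_interval ?f"
      using m b by (intro integrable_const_bound[of _ 1]) auto
    then have "?f \<in> L1_space unit_interval \<inter> Linf_space unit_interval"
      using m b by (auto simp: L1_space_def Linf_space_def intro!: exI[of _ 1])
    then show ?thesis using interp unfolding interpolation_space_def by blast
  qed
  \<comment> \<open>Sequences start at \<open>0\<close> but the enumeration at \<open>1\<close>:
    \<open>K n\<close> and \<open>I n\<close> are the row and position of
    \<open>\<phi> (Suc n)\<close>.\<close>
  obtain K I where KI: "\<And>n. 1 \<le> I n" "\<And>n. I n \<le> K n" "\<And>n. Suc n = K n * (K n - 1) div 2 + I n"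
    using triangular_index_exists by metis
  have \<phi>: "\<phi> (Suc n) = (\<lambda>t. rademacher (I n) t * rademacher (K n + 1) t)" for n
    using enum[of "K n" "I n"] KI[of n] by simp
  have le_iff: "n \<le> p \<longleftrightarrow> K n < K p \<or> K n = K p \<and> I n \<le> I p" for n p
  proof (cases "K n" "K p" rule: linorder_cases)
    case less
    then show ?thesis using triangular_less[of "I p" "I n" "K n" "K p"] KI[of n] KI[of p] by simp
  next
    case equal
    then have "Suc n + I p = Suc p + I n" using KI(3)[of n] KI(3)[of p] by simp
    then show ?thesis using equal by linarith
  next
    case greater
    then show ?thesis using triangular_less[of "I n" "I p" "K p" "K n"] KI[of n] KI[of p] by simp
  qed
  have mem\<phi>: "\<phi> (Suc n) \<in> X" for n
    unfolding \<phi> by (rule mem)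
  have "\<not> (AE t in unit_interval. \<phi> (Suc n) t = 0)" for n
  proof
    assume "AE t in unit_interval. \<phi> (Suc n) t = 0"
    moreover have "AE t in unit_interval. \<bar>rademacher (I n) t\<bar> = 1"
      "AE t in unit_interval. \<bar>rademacher (K n + 1) t\<bar> = 1"
      using KI(1) by (auto intro: AE_rademacher_abs)
    ultimately have "AE t in unit_interval. False"
      by eventually_elim (auto simp: \<phi>)
    then have "emeasure unit_interval (space unit_interval) = 0"
      by (subst (asm) AE_iff_measurable[of "space unit_interval"]) auto
    then show False by (simp add: emeasure_restrict_space)
  qed
  moreover have "N (\<lambda>t. \<Sum>n<m. a n * \<phi> (Suc n) t) \<le> 3 * N (\<lambda>t. \<Sum>n<k. a n * \<phi> (Suc n) t)"
    if "m \<le> k" for a m k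
  proof (cases m)
    case 0
    have "0 \<le> N (\<lambda>t. \<Sum>n<k. a n * \<phi> (Suc n) t)"
      by (intro norm_nonneg sum_mem mem\<phi>)
    then show ?thesis using 0 by (simp add: norm_zero)
  next
    \<comment> \<open>The last term of a nonempty partial sum has index \<open>p\<close>; its row
      \<open>K p\<close> is the one that may be cut.\<close>
    case (Suc p)
    define P where "P A = (\<lambda>t. \<Sum>n\<in>A. a n * \<phi> (Suc n) t)" for A
    have PX: "P A \<in> X" for A
      unfolding P_def by (intro sum_mem mem\<phi>)
    have P_Un: "P (A \<union> B) = (\<lambda>t. P A t + P B t)" if "finite A" "finite B" "A \<inter> B = {}" for A B
      unfolding P_def using that by (intro ext sum.union_disjoint)
    have I_neq: "1 \<le> I n \<and> 1 \<le> K n + 1 \<and> I n \<noteq> K n + 1" for n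
      using KI(1,2)[of n] by linarith
    have contr: "N (P B) \<le> N (P A)"
      if "finite A" "finite L" "L \<subseteq> {2..}" "B = {n \<in> A. I n \<notin> L \<and> K n + 1 \<notin> L}" for A B L
      unfolding P_def \<phi> that(4)
      by (rule chaos_contraction[OF symm mem I_neq that(1-3)])
    \<comment> \<open>\<open>?F1\<close> and \<open>?F2\<close> are the rows through and before row
      \<open>K p\<close>, \<open>?F3\<close> is what \<open>?F\<close> contains of that row, and
      \<open>?F4\<close> is its beginning. With \<open>N (P ?F)\<close> as unit, \<open>?F1\<close>
      and \<open>?F2\<close> cost at most 1 each, so \<open>?F3\<close> and hence \<open>?F4\<close>
      at most 2, and \<open>?F2\<close> with \<open>?F4\<close> at most 3.\<close>
    let ?F = "{..<k}"
    let ?F1 = "{n \<in> ?F. K n \<le> K p}"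
    let ?F2 = "{n \<in> ?F. K n < K p}"
    let ?F3 = "{n \<in> ?F. K n = K p}"
    let ?F4 = "{n \<in> ?F. K n = K p \<and> I n \<le> I p}"
    \<comment> \<open>Row \<open>K n\<close> carries the larger index \<open>K n + 1\<close>, whence
      the start at \<open>K p + 2\<close>. Rows occurring before position \<open>k\<close> are at
      most \<open>K k\<close>, so a finite set of indices suffices.\<close>
    have F1: "?F1 = {n \<in> ?F. I n \<notin> {K p + 2..K k + 1} \<and> K n + 1 \<notin> {K p + 2..K k + 1}}"
    proof (intro Collect_cong conj_cong refl)
      fix n assume "n \<in> ?F"
      then have "K n \<le> K k" using le_iff[of n k] by auto
      then show "K n \<le> K p \<longleftrightarrow> I n \<notin> {K p + 2..K k + 1} \<and> K n + 1 \<notin> {K p + 2..K k + 1}"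
        using KI(2)[of n] by auto
    qed
    have F2: "?F2 = {n \<in> ?F1. I n \<notin> {K p + 1} \<and> K n + 1 \<notin> {K p + 1}}"
    proof (intro set_eqI)
      show "n \<in> ?F2 \<longleftrightarrow> n \<in> {n \<in> ?F1. I n \<notin> {K p + 1} \<and> K n + 1 \<notin> {K p + 1}}" for n
        using KI(2)[of n] by auto
    qed
    \<comment> \<open>Within the row the common index \<open>K p + 1\<close> lies outside the
      deleted range, so only the smaller index decides. The range starts at \<open>I p + 1\<close>,
      which is at least \<open>2\<close>.\<close>
    have F4: "?F4 = {n \<in> ?F3. I n \<notin> {I p + 1..K p} \<and> K n + 1 \<notin> {I p + 1..K p}}"
    proof (intro set_eqI)
      show "n \<in> ?F4 \<longleftrightarrow> n \<in> {n \<in> ?F3. I n \<notin> {I p + 1..K p} \<and> K n + 1 \<notin> {I p + 1..K p}}" for n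
        using KI(2)[of n] by auto
    qed
    have "N (P ?F1) \<le> N (P ?F)"
      by (rule contr[OF _ _ _ F1]) auto
    moreover have "N (P ?F2) \<le> N (P ?F1)"
      using KI(1,2)[of p] by (intro contr[OF _ _ _ F2]) auto
    moreover have "N (P ?F4) \<le> N (P ?F3)"
      using KI(1)[of p] by (intro contr[OF _ _ _ F4]) auto
    moreover have "N (P ?F3) \<le> N (P ?F1) + N (P ?F2)"
    proof -
      have "?F1 = ?F2 \<union> ?F3" by (intro set_eqI) auto
      moreover have "P (?F2 \<union> ?F3) = (\<lambda>t. P ?F2 t + P ?F3 t)"
        by (rule P_Un) auto
      ultimately have *: "P ?F1 = (\<lambda>t. P ?F2 t + P ?F3 t)"
        by (rule trans[OF arg_cong[of _ _ P]])
      have "P ?F3 t = P ?F1 t - P ?F2 t" for t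
        using fun_cong[OF *, of t] by linarith
      then have **: "P ?F3 = (\<lambda>t. P ?F1 t - P ?F2 t)" by (rule ext)
      show ?thesis unfolding ** by (rule norm_diff[OF PX PX])
    qed
    moreover have "N (P {..<m}) \<le> N (P ?F2) + N (P ?F4)"
    proof -
      \<comment> \<open>Since \<open>m \<le> k\<close>, all indices up to \<open>p\<close> lie in
        \<open>?F\<close>, and by the lexicographic order they form the earlier rows and the
        beginning of row \<open>K p\<close>.\<close>
      have "{..<m} = ?F2 \<union> ?F4"
      proof (intro set_eqI)
        show "n \<in> {..<m} \<longleftrightarrow> n \<in> ?F2 \<union> ?F4" for n
          using that Suc le_iff[of n p] by auto
      qed
      moreover have "P (?F2 \<union> ?F4) = (\<lambda>t. P ?F2 t + P ?F4 t)"
        by (rule P_Un) auto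
      ultimately have *: "P {..<m} = (\<lambda>t. P ?F2 t + P ?F4 t)"
        by (rule trans[OF arg_cong[of _ _ P]])
      show ?thesis unfolding * by (rule norm_add[OF PX PX])
    qed
    ultimately show ?thesis unfolding P_def by linarith
  qed
  ultimately show ?thesis
    by (intro basic_sequence_if_basis_inequality[where C = 3] mem\<phi>)
qed

end
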